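(* For all $n\ge 10$, $\beta_n\ge\alpha_n$ and $\delta_n\ge\gamma_n$, where the sequences are as defined in the context.
   Context: For a positive integer $a$ with decimal expansion $a=\sum_{i=0}^{k} c_i 10^i$, $c_i\in\{0,\dots,9\}$, $c_k\neq 0$, and an integer $b\ge 10$, let $a\_b:=\sum_{i=0}^{k} c_i b^i$ (the decimal digit string of $a$ interpreted in base $b$); this is again a positive integer. Define for $n\ge 10$: $\alpha_{10}=10$ and $\alpha_n = 10\_(11\_(12\_(\cdots\_((n-1)\_n)\cdots)))$ for $n\ge 11$; $\beta_{10}=10$ and $\beta_n = ((\cdots((10\_11)\_12)\cdots)\_(n-1))\_n$ for $n\ge 11$; $\gamma_{10}=10$ and $\gamma_n = n\_((n-1)\_(\cdots\_(12\_(11\_10))\cdots))$ for $n\ge 11$; $\delta_{10}=10$ and $\delta_n = ((\cdots((n\_(n-1))\_(n-2))\cdots)\_11)\_10$ for $n\ge 11$. *)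

theory Defs
  imports Main
begin

text \<open>
  The index set consists exactly of the positions of the decimal digits of \<open>a\<close>;
  \<open>subscript_eq\<close> below is the characterisation by an arbitrary decimal expansion.
\<close>

definition subscript :: "nat \<Rightarrow> nat \<Rightarrow> nat" where
  "subscript a b = (\<Sum>i | 10 ^ i \<le> a. (a div 10 ^ i mod 10) * b ^ i)"

definition alpha :: "nat \<Rightarrow> nat" where
  "alpha n = foldr subscript [10..<n] n"

definition beta :: "nat \<Rightarrow> nat" where
  "beta n = foldl subscript 10 [11..<Suc n]"

definition gamma :: "nat \<Rightarrow> nat" where
  "gamma n = foldr subscript (rev [11..<Suc n]) 10"

definition delta :: "nat \<Rightarrow> nat" where
  "delta n = foldl subscript n (rev [10..<n])"

lemma decimal_sum_less:
  fixes c :: "nat \<Rightarrow> nat"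
  assumes "\<And>i. i < k \<Longrightarrow> c i \<le> 9"
  shows "(\<Sum>i<k. c i * 10 ^ i) < 10 ^ k"
  using assms
proof (induction k)
  case (Suc k)
  have "(\<Sum>i<k. c i * 10 ^ i) < 10 ^ k" using Suc by simp
  moreover have "c k * 10 ^ k \<le> 9 * 10 ^ k" using Suc.prems[of k] by simp
  ultimately show ?case unfolding sum.lessThan_Suc power_Suc by linarith
qed simp

lemma decimal_digit:
  fixes c :: "nat \<Rightarrow> nat"
  assumes "\<And>i. i \<le> k \<Longrightarrow> c i \<le> 9" and "j \<le> k"
  shows "(\<Sum>i\<le>k. c i * 10 ^ i) div 10 ^ j mod 10 = c j"
  using assms
proof (induction j arbitrary: c k)
  case 0
  have "(\<Sum>i\<le>k. c i * 10 ^ i) mod 10 = c 0"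
  proof (cases k)
    case (Suc m)
    have "(\<Sum>i\<le>k. c i * 10 ^ i) = c 0 + 10 * (\<Sum>i\<le>m. c (Suc i) * 10 ^ i)"
      unfolding Suc sum.atMost_Suc_shift by (simp add: sum_distrib_left mult_ac)
    then show ?thesis using 0(1)[of 0] by simp
  qed (use 0(1)[of 0] in simp)
  then show ?case by simp
next
  case (Suc j)
  then obtain m where k: "k = Suc m" by (cases k) auto
  have eq: "(\<Sum>i\<le>k. c i * 10 ^ i) = c 0 + 10 * (\<Sum>i\<le>m. c (Suc i) * 10 ^ i)"
    unfolding k sum.atMost_Suc_shift by (simp add: sum_distrib_left mult_ac)
  have "c 0 \<le> 9" using Suc.prems by simp
  then have "(\<Sum>i\<le>k. c i * 10 ^ i) div 10 = (\<Sum>i\<le>m. c (Suc i) * 10 ^ i)"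
    unfolding eq by simp
  moreover have "(\<Sum>i\<le>m. c (Suc i) * 10 ^ i) div 10 ^ j mod 10 = c (Suc j)"
    by (rule Suc.IH) (use Suc.prems k in auto)
  ultimately show ?case by (simp add: div_mult2_eq)
qed

lemma subscript_eq:
  fixes c :: "nat \<Rightarrow> nat"
  assumes digits: "\<And>i. i \<le> k \<Longrightarrow> c i \<le> 9" and lead: "c k \<noteq> 0"
    and a: "a = (\<Sum>i\<le>k. c i * 10 ^ i)"
  shows "subscript a b = (\<Sum>i\<le>k. c i * b ^ i)"
proof -
  have "a < 10 ^ Suc k"
    using decimal_sum_less[of "Suc k" c] digits unfolding a lessThan_Suc_atMost by simp
  moreover have "10 ^ k \<le> a"
  proof -
    have "10 ^ k \<le> c k * 10 ^ k" using lead by simp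
    also have "\<dots> \<le> a" unfolding a by (rule member_le_sum) auto
    finally show ?thesis .
  qed
  ultimately have "10 ^ i \<le> a \<longleftrightarrow> i \<le> k" for i
    by (meson le_trans linorder_not_le not_less_eq_eq one_le_numeral power_increasing)
  then have "{i. 10 ^ i \<le> a} = {..k}" by auto
  then show ?thesis
    unfolding subscript_def using decimal_digit[OF digits] a by (auto intro: sum.cong)
qed

lemma alpha_10: "alpha 10 = 10" and beta_10: "beta 10 = 10"
  and gamma_10: "gamma 10 = 10" and delta_10: "delta 10 = 10"
  by (simp_all add: alpha_def beta_def gamma_def delta_def)

lemma alpha_13: "alpha 13 = subscript 10 (subscript 11 (subscript 12 13))"
  and beta_13: "beta 13 = subscript (subscript (subscript 10 11) 12) 13"
  and gamma_13: "gamma 13 = subscript 13 (subscript 12 (subscript 11 10))"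
  and delta_13: "delta 13 = subscript (subscript (subscript 13 12) 11) 10"
  by (simp_all add: alpha_def beta_def gamma_def delta_def upt_rec)

end

theory Submission
  imports Defs
begin

text \<open>
  For a base \<open>c \<ge> 10\<close> the map \<open>x \<mapsto> subscript x c\<close> is superadditive, because a decimal
  carry trades \<open>10 * c ^ i\<close> for \<open>c ^ Suc i\<close>; it is therefore also supermultiplicative.
  Applying it to the expansion of \<open>subscript a b\<close> in powers of \<open>b\<close> gives
  \<open>subscript a (subscript b c) \<le> subscript (subscript a b) c\<close>. So moving brackets to the left
  never decreases an iterated subscript, and both inequalities compare the right-bracketed with
  the left-bracketed form of the same sequence.
\<close>

lemma subscript_0 [simp]: "subscript 0 b = 0"
  by (simp add: subscript_def)

text \<open>Horner's rule: the digit positions of \<open>a\<close> are 0 and the successors of those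
  of \<open>a div 10\<close>. The inductions on numbers below strip the last decimal digit this
  way.\<close>

lemma subscript_rec: "subscript a b = b * subscript (a div 10) b + a mod 10"
proof (cases "a = 0")
  case False
  let ?S = "{i. 10 ^ i \<le> a div 10}"
  \<comment> \<open>A sum over an infinite set defaults to 0, so finiteness is what allows index 0
    to be split off.\<close>
  have fin: "finite ?S"
  proof (rule finite_subset)
    show "?S \<subseteq> {..a div 10}"
    proof
      fix i assume "i \<in> ?S"
      moreover have "i < 10 ^ i" by (rule less_exp[THEN less_le_trans]) (simp add: power_mono)
      ultimately show "i \<in> {..a div 10}" by simp
    qed
  qed simp
  have "{i. 10 ^ i \<le> a} = insert 0 (Suc ` ?S)"
  proof (rule set_eqI)
    fix i
    show "i \<in> {i. 10 ^ i \<le> a} \<longleftrightarrow> i \<in> insert 0 (Suc ` ?S)"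
      using False by (cases i) (auto simp: less_eq_div_iff_mult_less_eq mult.commute)
  qed
  then have "subscript a b = (\<Sum>i\<in>insert 0 (Suc ` ?S). (a div 10 ^ i mod 10) * b ^ i)"
    by (simp add: subscript_def)
  also have "\<dots> = a mod 10 + (\<Sum>i\<in>?S. (a div 10 ^ Suc i mod 10) * b ^ Suc i)"
    using fin by (simp add: sum.reindex del: power_Suc)
  also have "\<dots> = b * subscript (a div 10) b + a mod 10"
    by (simp add: subscript_def sum_distrib_left div_mult2_eq mult_ac)
  finally show ?thesis .
qed simp

lemma subscript_append_digit:
  "d < 10 \<Longrightarrow> subscript (10 * p + d) b = b * subscript p b + d"
  by (subst subscript_rec) simp

lemma subscript_digit: "d < 10 \<Longrightarrow> subscript d b = d"
  by (subst subscript_rec) simp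

lemma subscript_ge:
  assumes "10 \<le> b"
  shows "a \<le> subscript a b"
proof (induction a rule: less_induct)
  case (less a)
  show ?case
  proof (cases "a = 0")
    case False
    then have "a div 10 \<le> subscript (a div 10) b" by (intro less.IH) simp
    with assms have "10 * (a div 10) \<le> b * subscript (a div 10) b" by (intro mult_mono) auto
    moreover have "a = 10 * (a div 10) + a mod 10" by simp
    ultimately show ?thesis by (subst subscript_rec) linarith
  qed simp
qed

lemma subscript_add_ge:
  assumes "10 \<le> b"
  shows "subscript x b + subscript y b \<le> subscript (x + y) b"
proof (induction "x + y" arbitrary: x y rule: less_induct)
  case less
  define p d q e where defs: "p = x div 10" "d = x mod 10" "q = y div 10" "e = y mod 10"
  have x: "x = 10 * p + d" and y: "y = 10 * q + e" and "d < 10" "e < 10"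
    by (simp_all add: defs)
  have rec: "subscript x b = b * subscript p b + d" "subscript y b = b * subscript q b + e"
    by (simp_all add: defs subscript_rec[of x] subscript_rec[of y])
  show ?case
  proof (cases "x + y = 0")
    case False
    then have pq: "subscript p b + subscript q b \<le> subscript (p + q) b"
      using x y by (intro less) linarith
    show ?thesis
    proof (cases "d + e < 10")
      case True
      then have "subscript (x + y) b = b * subscript (p + q) b + (d + e)"
        using subscript_append_digit[of "d + e" "p + q" b] by (simp add: x y add_ac)
      moreover have "b * (subscript p b + subscript q b) \<le> b * subscript (p + q) b"
        using pq by simp
      ultimately show ?thesis by (simp add: rec distrib_left)
    next
      case carry: False
      then have "x + y = 10 * (p + q + 1) + (d + e - 10)" using x y by simp
      moreover have "d + e - 10 < 10" using \<open>d < 10\<close> \<open>e < 10\<close> by simp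
      ultimately have "subscript (x + y) b = b * subscript (p + q + 1) b + (d + e - 10)"
        using subscript_append_digit by metis
      \<comment> \<open>The carry adds 1 to the upper part, hence a second use of the induction
        hypothesis, for \<open>p + q\<close> and \<open>1\<close>. It applies because a carry forces
        \<open>x + y\<close> to be at least \<open>10 * (p + q + 1)\<close>.\<close>
      moreover have "subscript (p + q) b + subscript 1 b \<le> subscript (p + q + 1) b"
        using x y carry by (intro less) linarith
      then have "subscript p b + subscript q b + 1 \<le> subscript (p + q + 1) b"
        using pq by (simp add: subscript_digit)
      then have "b * (subscript p b + subscript q b + 1) \<le> b * subscript (p + q + 1) b"
        by (rule mult_le_mono2)
      \<comment> \<open>The carry is worth \<open>b\<close>, which covers the 10 removed from the
        last digit.\<close>
      ultimately show ?thesis using assms carry by (simp add: rec distrib_left)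
    qed
  qed simp
qed

text \<open>Superadditivity iterated; the multiplier \<open>k\<close> itself is not reinterpreted.
  In the product bound it handles the last digit.\<close>

lemma subscript_scale_ge:
  assumes "10 \<le> b"
  shows "k * subscript x b \<le> subscript (k * x) b"
proof (induction k)
  case (Suc k)
  then show ?case using subscript_add_ge[OF assms, of x "k * x"] by simp
qed simp

text \<open>Split \<open>x * y\<close> as \<open>10 * (p * y) + d * y\<close>. Appending a zero
  digit multiplies the value by exactly \<open>b\<close>, scaling bounds the digit part, and
  superadditivity joins the two.\<close>

lemma subscript_mult_ge:
  assumes "10 \<le> b"
  shows "subscript x b * subscript y b \<le> subscript (x * y) b"
proof (induction x rule: less_induct)
  case (less x)
  show ?case
  proof (cases "x = 0")
    case False
    define p d where "p = x div 10" and "d = x mod 10"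
    then have x: "x = 10 * p + d" by simp
    have "subscript p b * subscript y b \<le> subscript (p * y) b"
      using False by (intro less) (simp add: p_def)
    then have "b * (subscript p b * subscript y b) \<le> b * subscript (p * y) b" by simp
    also have "\<dots> = subscript (10 * (p * y)) b" by (simp add: subscript_rec[of "10 * (p * y)"])
    finally have "b * (subscript p b * subscript y b) + d * subscript y b
        \<le> subscript (10 * (p * y)) b + subscript (d * y) b"
      using subscript_scale_ge[OF assms] by (rule add_mono)
    also have "\<dots> \<le> subscript (10 * (p * y) + d * y) b"
      by (rule subscript_add_ge[OF assms])
    also have "10 * (p * y) + d * y = x * y" by (simp add: x distrib_right)
    finally show ?thesis
      by (simp add: subscript_rec[of x] p_def d_def distrib_right mult.assoc)
  qed simp
qed

lemma subscript_assoc_ge: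
  assumes "10 \<le> c"
  shows "subscript a (subscript b c) \<le> subscript (subscript a b) c"
proof (induction a rule: less_induct)
  case (less a)
  show ?case
  proof (cases "a = 0")
    case False
    define p d where "p = a div 10" and "d = a mod 10"
    \<comment> \<open>Used at two bases: \<open>e = subscript b c\<close> for the left side and
      \<open>e = b\<close> for the inner term on the right.\<close>
    have rec: "subscript a e = e * subscript p e + d" for e
      by (simp add: p_def d_def subscript_rec[of a])
    have "subscript p (subscript b c) \<le> subscript (subscript p b) c"
      using False by (intro less) (simp add: p_def)
    then have "subscript b c * subscript p (subscript b c)
        \<le> subscript b c * subscript (subscript p b) c" by simp
    also have "\<dots> \<le> subscript (b * subscript p b) c"
      by (rule subscript_mult_ge[OF assms])
    finally have "subscript a (subscript b c) \<le> subscript (b * subscript p b) c + subscript d c"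
      by (simp add: rec subscript_digit d_def)
    also have "\<dots> \<le> subscript (subscript a b) c"
      unfolding rec[of b] by (rule subscript_add_ge[OF assms])
    finally show ?thesis .
  qed simp
qed

text \<open>A right-bracketed tail serves as the base \<open>c\<close> in
  \<open>subscript_assoc_ge\<close>, so it must be at least 10.\<close>

lemma foldr_subscript_ge_10:
  assumes "10 \<le> c" and "\<forall>b\<in>set bs. 10 \<le> b"
  shows "10 \<le> foldr subscript bs c"
  using assms(2)
proof (induction bs)
  case (Cons b bs)
  then have "b \<le> subscript b (foldr subscript bs c)" by (intro subscript_ge) simp
  with Cons.prems show ?case by simp
qed (use assms(1) in simp)

text \<open>One reassociation absorbs \<open>b\<close> into the head, and the induction hypothesis
  continues with \<open>subscript a b\<close> as the new head. Changing the head in this way avoids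
  any appeal to monotonicity of \<open>subscript\<close>.\<close>

lemma foldr_subscript_le_foldl:
  assumes "10 \<le> c" and "\<forall>b\<in>set bs. 10 \<le> b"
  shows "foldr subscript (a # bs) c \<le> foldl subscript a (bs @ [c])"
  using assms(2)
proof (induction bs arbitrary: a)
  case (Cons b bs)
  have "subscript a (subscript b (foldr subscript bs c))
      \<le> subscript (subscript a b) (foldr subscript bs c)"
    using assms(1) Cons.prems by (intro subscript_assoc_ge foldr_subscript_ge_10) auto
  also have "\<dots> \<le> foldl subscript (subscript a b) (bs @ [c])"
    using Cons.IH[of "subscript a b"] Cons.prems by simp
  finally show ?case by simp
qed simp

theorem theorem2:
  fixes n :: nat
  assumes "n \<ge> 10"
  shows "beta n \<ge> alpha n \<and> delta n \<ge> gamma n"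
\<comment> \<open>At \<open>n = 10\<close> the sequence has a single entry, while the fold
  comparison needs separate first and last entries.\<close>
proof (cases "n = 10")
  case True
  then show ?thesis by (simp add: alpha_10 beta_10 gamma_10 delta_10)
next
  case False
  with assms have n: "11 \<le> n" by simp
  then have upt: "[10..<n] = 10 # [11..<n]" "[11..<Suc n] = [11..<n] @ [n]"
    by (simp_all add: upt_conv_Cons)
  have "alpha n \<le> beta n"
    unfolding alpha_def beta_def upt using n by (intro foldr_subscript_le_foldl) auto
  \<comment> \<open>The sequence is now descending: head \<open>n\<close>, last base 10.\<close>
  moreover have "gamma n \<le> delta n"
    using foldr_subscript_le_foldl[of 10 "rev [11..<n]" n]
    unfolding gamma_def delta_def upt by simp
  ultimately show ?thesis by simp
qed

end
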